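(* Assume that $r_{12}=r_{32}=0$ and $c_2=r_{21}+r_{23}$. Then $I^*=(y^{c_2}-x^{r_{21}}z^{r_{23}},\,z^{c_3})$.
   Context: Let $K$ be a field and let $n_1<n_2<n_3$ be positive integers with $\gcd(n_1,n_2,n_3)=1$ that minimally generate the numerical semigroup $H=\langle n_1,n_2,n_3\rangle$. Let $S=K[x,y,z]$ with the standard grading, and let $I=I_H$ be the kernel of $S\to K[t]$, $x\mapsto t^{n_1}$, $y\mapsto t^{n_2}$, $z\mapsto t^{n_3}$. For nonzero $f\in S$, $f^*$ is its homogeneous component of smallest degree, and $I^*=(f^*\mid 0\neq f\in I)$. Let $c_1,c_2,c_3$ be the smallest positive integers such that $c_1n_1\in\langle n_2,n_3\rangle$, $c_2n_2\in\langle n_1,n_3\rangle$, $c_3n_3\in\langle n_1,n_2\rangle$, and let $r_{ij}$ be non-negative integers with $c_1n_1=r_{12}n_2+r_{13}n_3$, $c_2n_2=r_{21}n_1+r_{23}n_3$, $c_3n_3=r_{31}n_1+r_{32}n_2$. *)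

theory Defs
  imports "HOL-Library.Poly_Mapping" "HOL-Computational_Algebra.Polynomial"
begin

section \<open>Numerical semigroups\<close>

inductive_set semigroup_gen :: "nat set \<Rightarrow> nat set" for A :: "nat set" where
  zero: "0 \<in> semigroup_gen A"
| gen: "a \<in> A \<Longrightarrow> a \<in> semigroup_gen A"
| add: "a \<in> semigroup_gen A \<Longrightarrow> b \<in> semigroup_gen A \<Longrightarrow> a + b \<in> semigroup_gen A"

definition minimally_generates :: "nat set \<Rightarrow> nat set \<Rightarrow> bool" where
  "minimally_generates A H \<longleftrightarrow>
     semigroup_gen A = H \<and> (\<forall>B. B \<subset> A \<longrightarrow> semigroup_gen B \<noteq> H)"

text \<open>The minimum exists as soon as \<open>A\<close> contains some \<open>a > 0\<close>, since then
  \<open>a * n\<close> is a multiple of \<open>a\<close> and hence in the semigroup.\<close>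

definition least_multiple :: "nat \<Rightarrow> nat set \<Rightarrow> nat" where
  "least_multiple n A = (LEAST c. 0 < c \<and> c * n \<in> semigroup_gen A)"


section \<open>The polynomial ring in three variables\<close>

datatype var = X | Y | Z

text \<open>A monomial is its exponent vector, a polynomial maps monomials to coefficients;
  multiplication on \<open>\<Rightarrow>\<^sub>0\<close> is convolution.\<close>

type_synonym 'a poly3 = "(var \<Rightarrow>\<^sub>0 nat) \<Rightarrow>\<^sub>0 'a"

definition indet :: "var \<Rightarrow> 'a::comm_ring_1 poly3" where
  "indet v = Poly_Mapping.single (Poly_Mapping.single v 1) 1"

definition total_degree :: "(var \<Rightarrow>\<^sub>0 nat) \<Rightarrow> nat" where
  "total_degree m = Poly_Mapping.lookup m X + Poly_Mapping.lookup m Y + Poly_Mapping.lookup m Z"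

definition homog_component :: "nat \<Rightarrow> 'a::comm_ring_1 poly3 \<Rightarrow> 'a poly3" where
  "homog_component d f =
     (\<Sum>m \<in> {m \<in> Poly_Mapping.keys f. total_degree m = d}. Poly_Mapping.single m (Poly_Mapping.lookup f m))"

text \<open>Only meaningful for \<open>f \<noteq> 0\<close>.\<close>

definition initial_form :: "'a::comm_ring_1 poly3 \<Rightarrow> 'a poly3" where
  "initial_form f = homog_component (LEAST d. homog_component d f \<noteq> 0) f"

text \<open>Ideals of a commutative ring are its submodules as a module over itself, so
  \<open>module.subspace (*)\<close> is the library's predicate for ideals.\<close>

lemma module_times: "module ((*) :: 'a::comm_ring_1 \<Rightarrow> 'a \<Rightarrow> 'a)"
  by unfold_locales (simp_all add: algebra_simps)

abbreviation ideal_gen :: "'a::comm_ring_1 set \<Rightarrow> 'a set" where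
  "ideal_gen A \<equiv> module.span (*) A"

definition initial_ideal :: "'a::comm_ring_1 poly3 set \<Rightarrow> 'a poly3 set" where
  "initial_ideal I = ideal_gen (initial_form ` (I - {0}))"


section \<open>The ideal of a monomial space curve\<close>

definition param_map :: "nat \<Rightarrow> nat \<Rightarrow> nat \<Rightarrow> 'a::comm_ring_1 poly3 \<Rightarrow> 'a poly" where
  "param_map n1 n2 n3 f = (\<Sum>m \<in> Poly_Mapping.keys f. [:Poly_Mapping.lookup f m:] *
     (monom 1 n1 ^ Poly_Mapping.lookup m X * monom 1 n2 ^ Poly_Mapping.lookup m Y * monom 1 n3 ^ Poly_Mapping.lookup m Z))"

definition curve_ideal :: "nat \<Rightarrow> nat \<Rightarrow> nat \<Rightarrow> 'a::comm_ring_1 poly3 set" where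
  "curve_ideal n1 n2 n3 = {f. param_map n1 n2 n3 f = 0}"

text \<open>\<open>param_map\<close> is the \<open>K\<close>-algebra homomorphism with
  \<open>x \<mapsto> t^n1\<close>, \<open>y \<mapsto> t^n2\<close>, \<open>z \<mapsto> t^n3\<close>.\<close>

lemma param_map_superset:
  assumes "finite A" "Poly_Mapping.keys f \<subseteq> A"
  shows "param_map n1 n2 n3 f = (\<Sum>m \<in> A. [:Poly_Mapping.lookup f m:] *
     (monom 1 n1 ^ Poly_Mapping.lookup m X * monom 1 n2 ^ Poly_Mapping.lookup m Y * monom 1 n3 ^ Poly_Mapping.lookup m Z))"
  unfolding param_map_def
  by (rule sum.mono_neutral_left) (use assms in \<open>auto simp: in_keys_iff\<close>)

lemma param_map_zero [simp]: "param_map n1 n2 n3 0 = 0"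
  by (simp add: param_map_def)

lemma param_map_single:
  "param_map n1 n2 n3 (Poly_Mapping.single m c) = [:c:] *
     (monom 1 n1 ^ Poly_Mapping.lookup m X * monom 1 n2 ^ Poly_Mapping.lookup m Y * monom 1 n3 ^ Poly_Mapping.lookup m Z)"
  by (subst param_map_superset[of "{m}"]) auto

lemma param_map_const: "param_map n1 n2 n3 (Poly_Mapping.single 0 c) = [:c:]"
  by (simp add: param_map_single)

lemma param_map_one: "param_map n1 n2 n3 1 = 1"
  using param_map_const[of n1 n2 n3 1] by (simp add: one_pCons)

lemma param_map_indet:
  "param_map n1 n2 n3 (indet X) = monom 1 n1"
  "param_map n1 n2 n3 (indet Y) = monom 1 n2"
  "param_map n1 n2 n3 (indet Z) = monom 1 n3"
  by (simp_all add: indet_def param_map_single lookup_single flip: one_pCons)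

lemma param_map_add: "param_map n1 n2 n3 (f + g) = param_map n1 n2 n3 f + param_map n1 n2 n3 g"
proof -
  let ?A = "Poly_Mapping.keys f \<union> Poly_Mapping.keys g"
  have fin: "finite ?A" by simp
  have *: "[:Poly_Mapping.lookup (f + g) m:] = [:Poly_Mapping.lookup f m:] + [:Poly_Mapping.lookup g m:]" for m
    by (simp add: lookup_add)
  show ?thesis
    using Poly_Mapping.keys_add[of f g]
    by (simp add: param_map_superset[OF fin] * sum.distrib ring_distribs del: add_pCons)
qed

lemma param_map_sum: "param_map n1 n2 n3 (sum h A) = (\<Sum>a\<in>A. param_map n1 n2 n3 (h a))"
  by (induction A rule: infinite_finite_induct) (simp_all add: param_map_add)

lemma poly3_eq_sum: "f = (\<Sum>m \<in> Poly_Mapping.keys f. Poly_Mapping.single m (Poly_Mapping.lookup f m))"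
  by (rule poly_mapping_eqI)
     (auto simp: lookup_sum lookup_single when_def in_keys_iff sum.delta)

lemma param_map_mult: "param_map n1 n2 n3 (f * g) = param_map n1 n2 n3 f * param_map n1 n2 n3 g"
proof -
  have "f * g = (\<Sum>m \<in> Poly_Mapping.keys f. \<Sum>k \<in> Poly_Mapping.keys g.
      Poly_Mapping.single (m + k) (Poly_Mapping.lookup f m * Poly_Mapping.lookup g k))"
    by (subst (1) poly3_eq_sum[of f], subst (1) poly3_eq_sum[of g])
       (simp add: sum_product mult_single)
  also have "param_map n1 n2 n3 \<dots> = (\<Sum>m \<in> Poly_Mapping.keys f. \<Sum>k \<in> Poly_Mapping.keys g.
      param_map n1 n2 n3 (Poly_Mapping.single m (Poly_Mapping.lookup f m)) *
      param_map n1 n2 n3 (Poly_Mapping.single k (Poly_Mapping.lookup g k)))"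
  proof -
    have "[:a * b:] = [:a:] * [:b:]" for a b :: 'a by simp
    then show ?thesis
      by (simp add: param_map_sum param_map_single lookup_add power_add mult_ac
               del: mult_pCons_left mult_pCons_right)
  qed
  also have "\<dots> = param_map n1 n2 n3 f * param_map n1 n2 n3 g"
    by (subst (3) poly3_eq_sum[of f], subst (3) poly3_eq_sum[of g])
       (simp only: param_map_sum sum_product)
  finally show ?thesis .
qed

end

theory Submission
  imports Defs
begin

text \<open>
  The hypotheses \<open>r12 = r32 = 0\<close> force the two relations for \<open>x\<close> and \<open>z\<close> to coincide: both say
  \<open>c1 n1 = c3 n3\<close>. Hence \<open>I\<close> contains \<open>z^c3 - x^c1\<close>, whose initial form is \<open>z^c3\<close> because
  \<open>n1 < n3\<close> gives \<open>c3 < c1\<close>, and it contains \<open>F = y^c2 - x^r21 z^r23\<close>, which is homogeneous because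
  \<open>c2 = r21 + r23\<close>. So \<open>J = (F, z^c3)\<close> is contained in \<open>I^*\<close>.

  For the other inclusion, call a monomial normal if its \<open>y\<close>-exponent is below \<open>c2\<close> and its
  \<open>z\<close>-exponent below \<open>c3\<close>. Two facts carry the proof.

  \<^item> Rewriting with \<open>y^c2 \<rightarrow> x^r21 z^r23\<close> and \<open>z^c3 \<rightarrow> x^c1\<close> turns any monomial \<open>m\<close> into a normal
    monomial \<open>\<nu>\<close> of the same weight (exponent of \<open>t\<close>). The first rule preserves the degree and is a
    congruence modulo \<open>J\<close>; the second one raises the degree and applies only to elements of \<open>J\<close>.
    So either \<open>\<nu>\<close> has the degree of \<open>m\<close> and \<open>m - \<nu> \<in> J\<close>, or \<open>\<nu>\<close> has larger degree and \<open>m \<in> J\<close>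
    (\<open>normal_form_exists\<close>).

  \<^item> Distinct normal monomials have distinct weights, by the minimality of \<open>c1\<close>, \<open>c2\<close>, \<open>c3\<close>
    (\<open>normal_weight_inj\<close>).

  Now let \<open>f \<in> I\<close> be nonzero of order \<open>d\<close>, and collect the terms of \<open>f\<close> of one weight \<open>w\<close>. Their
  coefficients sum to zero, and they all have the same normal form \<open>\<nu>\<close>. If \<open>\<nu>\<close> has degree larger
  than \<open>d\<close>, every one of these terms that has degree \<open>d\<close> lies in \<open>J\<close>. If \<open>\<nu>\<close> has degree \<open>d\<close>, then all
  of them have degree \<open>d\<close>, since degrees only grow under rewriting, and
  \<open>\<Sum> a_m m = \<Sum> a_m (m - \<nu>)\<close> lies in \<open>J\<close>. Either way, the part of \<open>f^*\<close> of weight \<open>w\<close> is in \<open>J\<close>.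
\<close>

section \<open>Initial forms\<close>

lemma lookup_homog_component:
  "Poly_Mapping.lookup (homog_component d f) m =
     (if total_degree m = d then Poly_Mapping.lookup f m else 0)"
  by (auto simp: homog_component_def lookup_sum lookup_single when_def in_keys_iff sum.delta)

lemma initial_form_eqI:
  assumes "g \<noteq> 0"
    and "\<And>m. m \<in> Poly_Mapping.keys g \<Longrightarrow> total_degree m = d"
    and "\<And>m. m \<in> Poly_Mapping.keys h \<Longrightarrow> d < total_degree m"
  shows "initial_form (g + h) = g"
proof -
  have lookup_g: "Poly_Mapping.lookup g m = 0" if "total_degree m \<noteq> d" for m
    using assms(2)[of m] that by (auto simp: in_keys_iff)
  have lookup_h: "Poly_Mapping.lookup h m = 0" if "total_degree m \<le> d" for m
    using assms(3)[of m] that by (auto simp: in_keys_iff)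
  have comp: "homog_component e (g + h) = (if e = d then g else 0)" if "e \<le> d" for e
    using that lookup_g lookup_h
    by (intro poly_mapping_eqI) (auto simp: lookup_homog_component lookup_add)
  have "(LEAST e. homog_component e (g + h) \<noteq> 0) = d"
  proof (rule Least_equality)
    show "homog_component d (g + h) \<noteq> 0"
      using comp[of d] assms(1) by simp
    show "d \<le> e" if "homog_component e (g + h) \<noteq> 0" for e
      using that comp[of e] by (cases "e < d") auto
  qed
  then show ?thesis
    using comp[of d] by (simp add: initial_form_def)
qed

lemma initial_formE:
  assumes "f \<noteq> 0"
  obtains d where "initial_form f = homog_component d f"
    and "\<And>m. m \<in> Poly_Mapping.keys f \<Longrightarrow> d \<le> total_degree m"
proof
  let ?d = "LEAST d. homog_component d f \<noteq> 0"
  show "initial_form f = homog_component ?d f"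
    by (simp add: initial_form_def)
  fix m assume "m \<in> Poly_Mapping.keys f"
  then have "Poly_Mapping.lookup (homog_component (total_degree m) f) m \<noteq> 0"
    by (simp add: lookup_homog_component in_keys_iff)
  then show "?d \<le> total_degree m"
    by (intro Least_le) auto
qed


section \<open>Monomials and their weights\<close>

definition exps :: "nat \<Rightarrow> nat \<Rightarrow> nat \<Rightarrow> var \<Rightarrow>\<^sub>0 nat" where
  "exps a b c = Poly_Mapping.single X a + Poly_Mapping.single Y b + Poly_Mapping.single Z c"

lemma lookup_exps [simp]:
  "Poly_Mapping.lookup (exps a b c) X = a"
  "Poly_Mapping.lookup (exps a b c) Y = b"
  "Poly_Mapping.lookup (exps a b c) Z = c"
  by (simp_all add: exps_def lookup_add lookup_single)

lemma exps_lookup: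
  "exps (Poly_Mapping.lookup m X) (Poly_Mapping.lookup m Y) (Poly_Mapping.lookup m Z) = m"
proof (rule poly_mapping_eqI)
  show "Poly_Mapping.lookup
      (exps (Poly_Mapping.lookup m X) (Poly_Mapping.lookup m Y) (Poly_Mapping.lookup m Z)) v =
      Poly_Mapping.lookup m v" for v
    by (cases v) simp_all
qed

lemma exps_cases [cases type]:
  obtains a b c where "m = exps a b c"
  using exps_lookup[of m] by metis

lemma exps_add [simp]: "exps a b c + exps a' b' c' = exps (a + a') (b + b') (c + c')"
  by (simp add: exps_def single_add algebra_simps)

lemma exps_eq_iff [simp]: "exps a b c = exps a' b' c' \<longleftrightarrow> a = a' \<and> b = b' \<and> c = c'"
  by (metis lookup_exps)

lemma total_degree_exps [simp]: "total_degree (exps a b c) = a + b + c"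
  by (simp add: total_degree_def)

abbreviation monomial :: "(var \<Rightarrow>\<^sub>0 nat) \<Rightarrow> 'a::comm_ring_1 poly3" where
  "monomial m \<equiv> Poly_Mapping.single m 1"

lemma indet_power: "indet v ^ k = monomial (Poly_Mapping.single v k)"
  by (induction k) (simp_all add: indet_def mult_single flip: single_add)

lemma indet_power_exps:
  "indet Y ^ b = monomial (exps 0 b 0)"
  "indet Z ^ c = monomial (exps 0 0 c)"
  "indet X ^ a = monomial (exps a 0 0)"
  by (simp_all add: indet_power exps_def)

definition weight :: "nat \<Rightarrow> nat \<Rightarrow> nat \<Rightarrow> (var \<Rightarrow>\<^sub>0 nat) \<Rightarrow> nat" where
  "weight n1 n2 n3 m =
     Poly_Mapping.lookup m X * n1 + Poly_Mapping.lookup m Y * n2 + Poly_Mapping.lookup m Z * n3"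

lemma weight_exps [simp]: "weight n1 n2 n3 (exps a b c) = a * n1 + b * n2 + c * n3"
  by (simp add: weight_def)

lemma param_map_eq_sum_weight:
  "param_map n1 n2 n3 f =
     (\<Sum>m \<in> Poly_Mapping.keys f. monom (Poly_Mapping.lookup f m) (weight n1 n2 n3 m))"
  unfolding param_map_def
  by (intro sum.cong)
     (simp_all add: weight_def monom_power mult_monom smult_monom algebra_simps)

lemma curve_ideal_coeff_sum:
  assumes "f \<in> curve_ideal n1 n2 n3"
  shows "(\<Sum>m \<in> {m \<in> Poly_Mapping.keys f. weight n1 n2 n3 m = w}. Poly_Mapping.lookup f m) = 0"
proof -
  have "0 = coeff (param_map n1 n2 n3 f) w"
    using assms by (simp add: curve_ideal_def)
  also have "\<dots> = (\<Sum>m \<in> Poly_Mapping.keys f.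
      if weight n1 n2 n3 m = w then Poly_Mapping.lookup f m else 0)"
    by (simp add: param_map_eq_sum_weight coeff_sum)
  also have "\<dots> = (\<Sum>m \<in> {m \<in> Poly_Mapping.keys f. weight n1 n2 n3 m = w}. Poly_Mapping.lookup f m)"
    by (simp add: sum.inter_filter)
  finally show ?thesis by simp
qed

lemma monomial_diff_in_curve_ideal:
  assumes "weight n1 n2 n3 m = weight n1 n2 n3 m'"
  shows "monomial m - monomial m' \<in> curve_ideal n1 n2 n3"
proof -
  have "param_map n1 n2 n3 (monomial m - monomial m' :: 'a poly3) + param_map n1 n2 n3 (monomial m')
      = param_map n1 n2 n3 (monomial m)"
    by (simp flip: param_map_add)
  then show ?thesis
    using assms by (simp add: curve_ideal_def param_map_eq_sum_weight)
qed

lemma ideal_single_times: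
  assumes "module.subspace (*) J" and "p \<in> J"
  shows "Poly_Mapping.single m a * p \<in> (J :: 'a::comm_ring_1 poly3 set)"
  using module.subspace_scale[OF module_times assms] .


section \<open>Normal monomials\<close>

text \<open>
  The numerical content of the hypotheses. The relations for \<open>x\<close> and \<open>z\<close> are the single equation
  \<open>c1 n1 = c3 n3\<close>, and each \<open>min\<close> assumption is the minimality of one of \<open>c1\<close>, \<open>c2\<close>, \<open>c3\<close>, with
  membership in a semigroup spelled out as a linear combination.
\<close>

locale shared_relation =
  fixes n1 n2 n3 c1 c2 c3 r21 r23 :: nat
  assumes n1_pos: "0 < n1" and n2_pos: "0 < n2" and n1_less_n3: "n1 < n3"
    and c2_pos: "0 < c2" and c3_pos: "0 < c3"
    and relation13: "c1 * n1 = c3 * n3"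
    and relation2: "c2 * n2 = r21 * n1 + r23 * n3"
    and degree2: "c2 = r21 + r23"
    and min1: "\<And>k i j. 0 < k \<Longrightarrow> k * n1 = i * n2 + j * n3 \<Longrightarrow> c1 \<le> k"
    and min2: "\<And>k i j. 0 < k \<Longrightarrow> k * n2 = i * n1 + j * n3 \<Longrightarrow> c2 \<le> k"
    and min3: "\<And>k i j. 0 < k \<Longrightarrow> k * n3 = i * n1 + j * n2 \<Longrightarrow> c3 \<le> k"
begin

lemma c3_less_c1: "c3 < c1"
proof (rule ccontr)
  assume "\<not> c3 < c1"
  then have "c1 * n1 \<le> c3 * n1" by simp
  also have "\<dots> < c3 * n3" using c3_pos n1_less_n3 by simp
  finally show False using relation13 by simp
qed

definition normal :: "(var \<Rightarrow>\<^sub>0 nat) \<Rightarrow> bool" where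
  "normal m \<longleftrightarrow> Poly_Mapping.lookup m Y < c2 \<and> Poly_Mapping.lookup m Z < c3"

lemma normal_exps [simp]: "normal (exps a b c) \<longleftrightarrow> b < c2 \<and> c < c3"
  by (simp add: normal_def)

text \<open>
  Cancelling common variables from two distinct normal monomials of equal weight leaves a power of
  one variable that has the same weight as a monomial in the other two. A power of
  \<open>y\<close> or \<open>z\<close> has too small an exponent for this. A power of \<open>x\<close> must be divisible by \<open>x^c1\<close>;
  trading \<open>x^c1\<close> for \<open>z^c3\<close> then isolates a power of \<open>y\<close>, again with too small an exponent.
\<close>

lemma normal_weight_inj_aux:
  assumes eq: "a * n1 + b * n2 + c * n3 = a' * n1 + b' * n2 + c' * n3"
    and bounds: "b' \<le> b" "b < c2" "c < c3" "c' < c3"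
  shows "a = a' \<and> b = b' \<and> c = c'"
proof -
  obtain k where k: "b = b' + k"
    using \<open>b' \<le> b\<close> le_Suc_ex by blast
  consider (le_le) "a \<le> a'" "c \<le> c'" | (ge_ge) "a' \<le> a" "c' \<le> c"
    | (gt_lt) "a' < a" "c < c'" | (lt_gt) "a < a'" "c' < c"
    by linarith
  then show ?thesis
  proof cases
    case le_le
    then obtain i j where ij: "a' = a + i" "c' = c + j"
      using le_Suc_ex by blast
    with k eq have rel: "k * n2 = i * n1 + j * n3"
      by (simp add: algebra_simps)
    then have "k = 0"
      using min2[of k i j] k bounds by (cases "k = 0") auto
    with rel ij k n1_pos n1_less_n3 show ?thesis by simp
  next
    case ge_ge
    then obtain i j where ij: "a = a' + i" "c = c' + j"
      using le_Suc_ex by blast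
    with k eq have "i * n1 + k * n2 + j * n3 = 0"
      by (simp add: algebra_simps)
    with ij k n1_pos n2_pos n1_less_n3 show ?thesis by simp
  next
    case gt_lt
    then obtain i j where ij: "a = a' + i" "c' = c + j" "0 < j"
      by (metis less_imp_add_positive)
    with k eq have "j * n3 = i * n1 + k * n2"
      by (simp add: algebra_simps)
    with min3[of j i k] ij bounds show ?thesis by simp
  next
    case lt_gt
    then obtain i j where ij: "a' = a + i" "c = c' + j" "0 < i"
      by (metis less_imp_add_positive)
    with k eq have rel: "i * n1 = k * n2 + j * n3"
      by (simp add: algebra_simps)
    then obtain i' where i': "i = c1 + i'"
      using min1 ij le_Suc_ex by blast
    have "j < c3" using ij bounds by simp
    then obtain j' where j': "c3 = j + j'" "0 < j'"
      by (metis less_imp_add_positive)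
    have "c1 * n1 = j * n3 + j' * n3"
      using relation13 j' by (simp add: algebra_simps)
    with rel i' have rel': "k * n2 = i' * n1 + j' * n3"
      by (simp add: algebra_simps)
    then have "0 < k"
      using j' n1_less_n3 by (cases "k = 0") auto
    with min2[OF _ rel'] k bounds show ?thesis by simp
  qed
qed

lemma normal_weight_inj:
  assumes "normal m" and "normal m'" and "weight n1 n2 n3 m = weight n1 n2 n3 m'"
  shows "m = m'"
proof -
  obtain a b c a' b' c' where m: "m = exps a b c" "m' = exps a' b' c'"
    by (metis exps_lookup)
  show ?thesis
  proof (cases "b' \<le> b")
    case True
    then show ?thesis
      using assms m normal_weight_inj_aux[of a b c a' b' c'] by simp
  next
    case False
    then show ?thesis
      using assms m normal_weight_inj_aux[of a' b' c' a b c] by simp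
  qed
qed

text \<open>
  Rewriting with \<open>y^c2 \<rightarrow> x^r21 z^r23\<close> alone: it stays in one degree, and terminates because the
  \<open>y\<close>-exponent drops.
\<close>

lemma reduce_y:
  fixes J :: "'a::comm_ring_1 poly3 set"
  assumes J: "module.subspace (*) J"
    and F: "monomial (exps 0 c2 0) - monomial (exps r21 0 r23) \<in> J"
  shows "\<exists>a' b' c'. b' < c2 \<and> a' + b' + c' = a + b + c
    \<and> weight n1 n2 n3 (exps a' b' c') = weight n1 n2 n3 (exps a b c)
    \<and> monomial (exps a b c) - monomial (exps a' b' c') \<in> J"
proof (induction b arbitrary: a c rule: less_induct)
  case (less b)
  show ?case
  proof (cases "b < c2")
    case True
    then show ?thesis
      using module.subspace_0[OF module_times J] by (intro exI[of _ a] exI[of _ b] exI[of _ c]) simp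
  next
    case False
    then obtain k where k: "b = c2 + k"
      using le_Suc_ex by (metis not_less)
    with c2_pos have "k < b" by simp
    from less.IH[OF this, of "a + r21" "c + r23"] obtain a' b' c' where
      *: "b' < c2" "a' + b' + c' = (a + r21) + k + (c + r23)"
         "weight n1 n2 n3 (exps a' b' c') = weight n1 n2 n3 (exps (a + r21) k (c + r23))"
         "monomial (exps (a + r21) k (c + r23)) - monomial (exps a' b' c') \<in> J"
      by blast
    have "monomial (exps a k c) * (monomial (exps 0 c2 0) - monomial (exps r21 0 r23)) \<in> J"
      using ideal_single_times[OF J F] .
    then have "monomial (exps a b c) - monomial (exps (a + r21) k (c + r23)) \<in> J"
      by (simp add: k right_diff_distrib mult_single add.commute[of k])
    from module.subspace_add[OF module_times J this *(4)]
    have "monomial (exps a b c) - monomial (exps a' b' c') \<in> J"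
      by simp
    moreover have "weight n1 n2 n3 (exps (a + r21) k (c + r23)) = weight n1 n2 n3 (exps a b c)"
      using relation2 k by (simp add: algebra_simps)
    ultimately show ?thesis
      using * k degree2 by (intro exI[of _ a'] exI[of _ b'] exI[of _ c']) auto
  qed
qed

text \<open>
  After the \<open>y\<close>-exponent has been reduced, the rule \<open>z^c3 \<rightarrow> x^c1\<close> applies \<open>c' div c3\<close> times. If it
  applies at all, then \<open>z^c3\<close> divides the current monomial, and since \<open>c3 < c1\<close> the degree grows.
\<close>

lemma normal_form_exists:
  fixes J :: "'a::comm_ring_1 poly3 set"
  assumes J: "module.subspace (*) J"
    and F: "monomial (exps 0 c2 0) - monomial (exps r21 0 r23) \<in> J"
    and zc3: "monomial (exps 0 0 c3) \<in> J"
  obtains \<nu> where "normal \<nu>" "weight n1 n2 n3 \<nu> = weight n1 n2 n3 m"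
    "total_degree m = total_degree \<nu> \<and> monomial m - monomial \<nu> \<in> J
      \<or> total_degree m < total_degree \<nu> \<and> monomial m \<in> J"
proof -
  obtain a b c where m: "m = exps a b c"
    by (rule exps_cases)
  obtain a' b' c' where
    *: "b' < c2" "a' + b' + c' = a + b + c"
       "weight n1 n2 n3 (exps a' b' c') = weight n1 n2 n3 m"
       "monomial m - monomial (exps a' b' c') \<in> J"
    using reduce_y[OF J F] m by blast
  show ?thesis
  proof (cases "c' < c3")
    case True
    with * m show ?thesis
      by (intro that[of "exps a' b' c'"]) auto
  next
    case False
    define p where "p = c' div c3"
    define s where "s = c' mod c3"
    have c': "c' = p * c3 + s" and s: "s < c3" and p: "0 < p"
      using False c3_pos by (auto simp: p_def s_def div_greater_zero_iff)
    show ?thesis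
    proof (rule that[of "exps (a' + p * c1) b' s"])
      show "normal (exps (a' + p * c1) b' s)"
        using * s by simp
      have "p * (c1 * n1) = p * (c3 * n3)"
        using relation13 by simp
      then show "weight n1 n2 n3 (exps (a' + p * c1) b' s) = weight n1 n2 n3 m"
        unfolding *(3)[symmetric] using c' by (simp add: algebra_simps)
      have "p * c3 < p * c1"
        using p c3_less_c1 by simp
      then have "total_degree m < total_degree (exps (a' + p * c1) b' s)"
        unfolding m total_degree_exps using *(2) c' by linarith
      moreover have "monomial m \<in> J"
      proof -
        have "monomial (exps a' b' (c' - c3)) * monomial (exps 0 0 c3) \<in> J"
          using ideal_single_times[OF J zc3] .
        then have "monomial (exps a' b' c') \<in> J"
          using False by (simp add: mult_single)
        from module.subspace_add[OF module_times J *(4) this] show ?thesis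
          by simp
      qed
      ultimately show "total_degree m = total_degree (exps (a' + p * c1) b' s)
          \<and> monomial m - monomial (exps (a' + p * c1) b' s) \<in> J
        \<or> total_degree m < total_degree (exps (a' + p * c1) b' s) \<and> monomial m \<in> J"
        by blast
    qed
  qed
qed


section \<open>The initial ideal\<close>

text \<open>
  The terms of degree \<open>d\<close> are treated one weight at a time: the coefficients of one weight sum to
  zero, but this speaks of all terms of that weight, so the degree bound is needed to see that the
  terms of higher degree do not interfere.
\<close>

lemma weight_part_in_ideal:
  fixes J :: "'a::comm_ring_1 poly3 set"
  assumes J: "module.subspace (*) J"
    and F: "monomial (exps 0 c2 0) - monomial (exps r21 0 r23) \<in> J"
    and zc3: "monomial (exps 0 0 c3) \<in> J"
    and f: "f \<in> curve_ideal n1 n2 n3"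
    and d: "\<And>m. m \<in> Poly_Mapping.keys f \<Longrightarrow> d \<le> total_degree m"
  shows "(\<Sum>m \<in> {m \<in> Poly_Mapping.keys f. total_degree m = d \<and> weight n1 n2 n3 m = w}.
    Poly_Mapping.single m (Poly_Mapping.lookup f m)) \<in> J" (is "sum ?t ?A \<in> J")
proof (cases "\<exists>\<nu>. normal \<nu> \<and> weight n1 n2 n3 \<nu> = w \<and> total_degree \<nu> = d")
  case True
  then obtain \<nu> where \<nu>: "normal \<nu>" "weight n1 n2 n3 \<nu> = w" "total_degree \<nu> = d"
    by blast
  have reduce: "total_degree m = d \<and> monomial m - monomial \<nu> \<in> J"
    if "m \<in> Poly_Mapping.keys f" "weight n1 n2 n3 m = w" for m
  proof -
    obtain \<mu> where "normal \<mu>" "weight n1 n2 n3 \<mu> = weight n1 n2 n3 m"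
      "total_degree m = total_degree \<mu> \<and> monomial m - monomial \<mu> \<in> J
        \<or> total_degree m < total_degree \<mu> \<and> monomial m \<in> J"
      by (rule normal_form_exists[OF J F zc3])
    moreover from this have "\<mu> = \<nu>"
      using normal_weight_inj \<nu> that by simp
    ultimately show ?thesis
      using \<nu> d[OF that(1)] by auto
  qed
  then have A: "?A = {m \<in> Poly_Mapping.keys f. weight n1 n2 n3 m = w}"
    by blast
  have t: "?t m = Poly_Mapping.single 0 (Poly_Mapping.lookup f m) * (monomial m - monomial \<nu>)
      + Poly_Mapping.single \<nu> (Poly_Mapping.lookup f m)" for m
    by (simp add: right_diff_distrib mult_single)
  have "sum ?t ?A = (\<Sum>m\<in>?A. Poly_Mapping.single 0 (Poly_Mapping.lookup f m) * (monomial m - monomial \<nu>))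
      + (\<Sum>m\<in>?A. Poly_Mapping.single \<nu> (Poly_Mapping.lookup f m))"
    by (subst t) (rule sum.distrib)
  also have "(\<Sum>m\<in>?A. Poly_Mapping.single \<nu> (Poly_Mapping.lookup f m))
      = Poly_Mapping.single \<nu> (\<Sum>m\<in>?A. Poly_Mapping.lookup f m)"
    by (intro poly_mapping_eqI) (simp add: lookup_sum lookup_single when_def)
  also have "\<dots> = 0"
    using curve_ideal_coeff_sum[OF f, of w] A by simp
  finally show ?thesis
    using reduce
    by (auto intro!: module.subspace_sum[OF module_times J] ideal_single_times[OF J])
next
  case False
  have "monomial m \<in> J" if "m \<in> ?A" for m
  proof -
    obtain \<mu> where "normal \<mu>" "weight n1 n2 n3 \<mu> = weight n1 n2 n3 m"
      "total_degree m = total_degree \<mu> \<and> monomial m - monomial \<mu> \<in> J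
        \<or> total_degree m < total_degree \<mu> \<and> monomial m \<in> J"
      by (rule normal_form_exists[OF J F zc3])
    with False that show ?thesis by auto
  qed
  then have "Poly_Mapping.single 0 (Poly_Mapping.lookup f m) * monomial m \<in> J" if "m \<in> ?A" for m
    using that by (intro ideal_single_times[OF J])
  then show ?thesis
    by (intro module.subspace_sum[OF module_times J]) (simp add: mult_single)
qed

lemma initial_form_in_ideal:
  fixes J :: "'a::comm_ring_1 poly3 set"
  assumes J: "module.subspace (*) J"
    and F: "monomial (exps 0 c2 0) - monomial (exps r21 0 r23) \<in> J"
    and zc3: "monomial (exps 0 0 c3) \<in> J"
    and f: "f \<in> curve_ideal n1 n2 n3" "f \<noteq> 0"
  shows "initial_form f \<in> J"
proof -
  obtain d where init: "initial_form f = homog_component d f"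
    and d: "\<And>m. m \<in> Poly_Mapping.keys f \<Longrightarrow> d \<le> total_degree m"
    using initial_formE[OF f(2)] by blast
  let ?A = "{m \<in> Poly_Mapping.keys f. total_degree m = d}"
  let ?t = "\<lambda>m. Poly_Mapping.single m (Poly_Mapping.lookup f m)"
  have "initial_form f = (\<Sum>w \<in> weight n1 n2 n3 ` ?A. sum ?t {m \<in> ?A. weight n1 n2 n3 m = w})"
    unfolding init homog_component_def by (rule sum.image_gen) simp
  also have "\<dots> \<in> J"
    by (rule module.subspace_sum[OF module_times J])
       (simp add: weight_part_in_ideal[OF J F zc3 f(1) d] conj_assoc)
  finally show ?thesis .
qed

lemma generators_in_initial_ideal:
  "monomial (exps 0 c2 0) - monomial (exps r21 0 r23)
     \<in> initial_form ` (curve_ideal n1 n2 n3 - {0 :: 'a::comm_ring_1 poly3})" (is "?F \<in> ?in")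
  "monomial (exps 0 0 c3) \<in> initial_form ` (curve_ideal n1 n2 n3 - {0 :: 'a::comm_ring_1 poly3})"
proof -
  have in_image: "g \<in> ?in" if "initial_form (g + h) = g" "g + h \<in> curve_ideal n1 n2 n3"
    "g + h \<noteq> 0" for g h
    using that by (metis DiffI image_eqI singletonD)
  have "Poly_Mapping.lookup ?F (exps 0 c2 0) \<noteq> 0"
    using c2_pos by (simp add: lookup_minus lookup_single when_def)
  then have "?F \<noteq> 0" by auto
  moreover have "total_degree m = c2" if "m \<in> Poly_Mapping.keys ?F" for m
    using that degree2 keys_diff[of "monomial (exps 0 c2 0)" "monomial (exps r21 0 r23)"] by auto
  ultimately show "?F \<in> ?in"
    using relation2
    by (intro in_image[of _ 0] initial_form_eqI[where d = c2])
       (auto intro!: monomial_diff_in_curve_ideal)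
  let ?G = "monomial (exps 0 0 c3) + (- monomial (exps c1 0 0)) :: 'a poly3"
  have "Poly_Mapping.lookup ?G (exps 0 0 c3) \<noteq> 0"
    using c3_pos by (simp add: lookup_minus lookup_single when_def)
  then have "?G \<noteq> 0" by auto
  moreover have "(monomial (exps 0 0 c3) :: 'a poly3) \<noteq> 0"
    by (metis lookup_single_eq lookup_zero zero_neq_one)
  moreover have "?G \<in> curve_ideal n1 n2 n3"
    using relation13 monomial_diff_in_curve_ideal[of n1 n2 n3 "exps 0 0 c3" "exps c1 0 0"] by simp
  ultimately show "monomial (exps 0 0 c3) \<in> ?in"
    using c3_less_c1
    by (intro in_image[of _ "- monomial (exps c1 0 0)"] initial_form_eqI[where d = c3]) auto
qed

lemma initial_ideal_curve:
  "initial_ideal (curve_ideal n1 n2 n3 :: 'a::comm_ring_1 poly3 set) =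
     ideal_gen {monomial (exps 0 c2 0) - monomial (exps r21 0 r23), monomial (exps 0 0 c3)}"
    (is "_ = ideal_gen ?B")
proof
  have J: "module.subspace (*) (ideal_gen ?B)"
    by (rule module.subspace_span[OF module_times])
  have "?B \<subseteq> ideal_gen ?B"
    by (rule module.span_superset[OF module_times])
  then show "initial_ideal (curve_ideal n1 n2 n3) \<subseteq> ideal_gen ?B"
    unfolding initial_ideal_def
    by (intro module.span_minimal[OF module_times _ J])
       (auto intro!: initial_form_in_ideal[OF J])
  show "ideal_gen ?B \<subseteq> initial_ideal (curve_ideal n1 n2 n3)"
    unfolding initial_ideal_def
    using generators_in_initial_ideal by (intro module.span_mono[OF module_times]) simp
qed

end


section \<open>From least multiples to the relations\<close>

lemma mult_in_semigroup_gen: "a \<in> A \<Longrightarrow> k * a \<in> semigroup_gen A"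
  by (induction k) (auto intro: semigroup_gen.intros)

lemma least_multiple_pos:
  assumes "a \<in> A" and "0 < a"
  shows "0 < least_multiple n A"
proof -
  have "0 < a \<and> a * n \<in> semigroup_gen A"
    using assms mult_in_semigroup_gen[of a A n] by (simp add: mult.commute)
  then show ?thesis
    unfolding least_multiple_def by (metis (mono_tags, lifting) LeastI)
qed

lemma least_multiple_le:
  assumes "0 < k" and "k * n = i * a + j * b"
  shows "least_multiple n {a, b} \<le> k"
proof -
  have "k * n \<in> semigroup_gen {a, b}"
    unfolding assms(2) by (intro semigroup_gen.add mult_in_semigroup_gen) simp_all
  with assms(1) show ?thesis
    unfolding least_multiple_def by (intro Least_le) simp
qed

theorem lemma3p11:
  fixes n1 n2 n3 c1 c2 c3 r12 r13 r21 r23 r31 r32 :: nat and H :: "nat set"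
    and I :: "'a::field poly3 set"
  assumes "0 < n1" and "n1 < n2" and "n2 < n3"
    and "Gcd {n1, n2, n3} = 1"
    and "minimally_generates {n1, n2, n3} H"
    and "I = curve_ideal n1 n2 n3"
    and "c1 = least_multiple n1 {n2, n3}"
    and "c2 = least_multiple n2 {n1, n3}"
    and "c3 = least_multiple n3 {n1, n2}"
    and "c1 * n1 = r12 * n2 + r13 * n3"
    and "c2 * n2 = r21 * n1 + r23 * n3"
    and "c3 * n3 = r31 * n1 + r32 * n2"
    and "r12 = 0" and "r32 = 0"
    and "c2 = r21 + r23"
  shows "initial_ideal I =
    ideal_gen {indet Y ^ c2 - indet X ^ r21 * indet Z ^ r23, indet Z ^ c3}"
proof -
  have pos: "0 < c1" "0 < c2" "0 < c3"
    using least_multiple_pos[of n2 "{n2, n3}" n1] least_multiple_pos[of n1 "{n1, n3}" n2]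
      least_multiple_pos[of n1 "{n1, n2}" n3] assms by simp_all
  have min1: "c1 \<le> k" if "0 < k" "k * n1 = i * n2 + j * n3" for k i j
    using least_multiple_le[OF that] assms by simp
  have min2: "c2 \<le> k" if "0 < k" "k * n2 = i * n1 + j * n3" for k i j
    using least_multiple_le[OF that] assms by simp
  have min3: "c3 \<le> k" if "0 < k" "k * n3 = i * n1 + j * n2" for k i j
    using least_multiple_le[OF that] assms by simp
  have x: "c1 * n1 = r13 * n3" and z: "c3 * n3 = r31 * n1"
    using assms by simp_all
  \<comment> \<open>The relation for \<open>x\<close> bounds \<open>c3\<close> and the relation for \<open>z\<close> bounds \<open>c1\<close>, so
    \<open>c3 n3 \<le> r13 n3 = c1 n1 \<le> r31 n1 = c3 n3\<close>.\<close>
  have "0 < r13" "0 < r31"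
    using x z pos assms(1-3) by (auto intro: gr0I)
  then have "c3 \<le> r13" "c1 \<le> r31"
    using min3[of r13 c1 0] min1[of r31 0 c3] x z by simp_all
  then have "c3 * n3 \<le> r13 * n3" "c1 * n1 \<le> r31 * n1"
    by simp_all
  with x z have "c1 * n1 = c3 * n3"
    by simp
  then interpret shared_relation n1 n2 n3 c1 c2 c3 r21 r23
    using assms(1-3) assms(11,15) pos min1 min2 min3 by unfold_locales auto
  show ?thesis
    using initial_ideal_curve by (simp add: assms(6) indet_power_exps mult_single)
qed

end
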